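(* Let $F$ be a field of characteristic not $2$, let $L/F$ be a biquadratic field extension and let $\alpha\in L$ be a biquadratic generator with minimal polynomial $P(X)=X^4+uX^2+w$ over $F$. The following are equivalent: \begin{enumerate} \item $L/F$ is a Galois extension; \item $u^2-4w$, $-u+2\omega$ and $-u-2\omega$ lie in $L^2$, where $\omega$ is an element of an algebraic closure of $F$ with $\omega^2=w$; \item $w\in L^2$. \end{enumerate}
   Context: $F$ is a field of characteristic different from $2$. A quartic extension $L/F$ is biquadratic if it has a primitive element $\alpha$ (a biquadratic generator) whose minimal polynomial over $F$ is of the form $X^4+uX^2+w$ with $u,w\in F$. $L^2$ denotes the set of squares in $L$. *)

theory Defs
  imports "HOL-Algebra.Algebraic_Closure" "HOL-Algebra.Generated_Fields"
begin

text \<open>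
  Field extensions $E/K$ are pairs of subfields $K \subseteq E$ of an ambient ring $R$, as in the
  library's theory of finite extensions. Polynomials are coefficient lists, leading coefficient first.
\<close>

definition (in ring) subfield_extension :: "'a set \<Rightarrow> 'a set \<Rightarrow> bool"
  where "subfield_extension K E \<longleftrightarrow> subfield K R \<and> subfield E R \<and> K \<subseteq> E"

definition (in ring) relative_automorphisms :: "'a set \<Rightarrow> 'a set \<Rightarrow> ('a \<Rightarrow> 'a) set"
  where "relative_automorphisms K E =
    {\<sigma> \<in> ring_iso (R\<lparr>carrier := E\<rparr>) (R\<lparr>carrier := E\<rparr>). \<forall>x\<in>K. \<sigma> x = x}"

text \<open>
  Galois in the sense of Artin and Bourbaki: algebraic, and the fixed field of the group of
  $K$-automorphisms of $E$ is $K$.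
\<close>

definition (in ring) galois_extension :: "'a set \<Rightarrow> 'a set \<Rightarrow> bool"
  where "galois_extension K E \<longleftrightarrow>
    subfield_extension K E \<and>
    (\<forall>x\<in>E. (algebraic over K) x) \<and>
    {x \<in> E. \<forall>\<sigma> \<in> relative_automorphisms K E. \<sigma> x = x} = K"

definition (in ring) biquadratic_poly :: "'a \<Rightarrow> 'a \<Rightarrow> 'a list"
  where "biquadratic_poly u w = [\<one>, \<zero>, u, \<zero>, w]"

text \<open>
  The term \<open>Irr K \<alpha>\<close> is a definite description, meaningful only for algebraic \<open>\<alpha>\<close>;
  hence the explicit algebraicity condition.
\<close>

definition (in ring) biquadratic_generator :: "'a set \<Rightarrow> 'a set \<Rightarrow> 'a \<Rightarrow> bool"
  where "biquadratic_generator K E \<alpha> \<longleftrightarrow>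
    \<alpha> \<in> E \<and> (algebraic over K) \<alpha> \<and> generate_field R (insert \<alpha> K) = E \<and>
    (\<exists>u\<in>K. \<exists>w\<in>K. Irr K \<alpha> = biquadratic_poly u w)"

definition (in ring) biquadratic_extension :: "'a set \<Rightarrow> 'a set \<Rightarrow> bool"
  where "biquadratic_extension K E \<longleftrightarrow>
    subfield_extension K E \<and> dimension 4 K E \<and> (\<exists>\<alpha>. biquadratic_generator K E \<alpha>)"

definition (in ring) squares :: "'a set \<Rightarrow> 'a set"
  where "squares E = (\<lambda>x. x [^] (2::nat)) ` E"

end

theory Submission
  imports Defs
begin

text \<open>
  An automorphism moving \<open>\<alpha>\<^sup>2\<close> exchanges the two roots of \<open>Y\<^sup>2 + uY + w\<close>, so if \<open>L/F\<close> is Galois then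
  \<open>w\<close> is the square of the product of \<open>\<alpha>\<close> and its image. Conversely, if \<open>\<omega> \<in> L\<close>, put \<open>\<beta> = \<omega>/\<alpha>\<close>; then \<open>\<alpha>\<^sup>2 + \<beta>\<^sup>2 = -u\<close> and
  \<open>\<alpha>\<beta> = \<omega>\<close>, whence \<open>-u \<plusminus> 2\<omega> = (\<alpha> \<plusminus> \<beta>)\<^sup>2\<close> and \<open>u\<^sup>2 - 4w = (\<alpha>\<^sup>2 - \<beta>\<^sup>2)\<^sup>2\<close>. The roots of \<open>P\<close> are
  \<open>\<plusminus>\<alpha>, \<plusminus>\<beta>\<close>, and the automorphisms \<open>\<alpha> \<mapsto> -\<alpha>\<close> and \<open>\<alpha> \<mapsto> \<beta>\<close> already have fixed field \<open>F\<close>: the first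
  kills the odd coordinates in the basis \<open>1, \<alpha>, \<alpha>\<^sup>2, \<alpha>\<^sup>3\<close>, the second the coordinate of \<open>\<alpha>\<^sup>2\<close>.
\<close>

section \<open>Conjugate roots and automorphisms of a simple extension\<close>

lemma (in domain) Irr_of_root:
  assumes K: "subfield K R" and x: "x \<in> carrier R" "(algebraic over K) x"
    and y: "y \<in> carrier R" "eval (Irr K x) y = \<zero>"
  shows "(algebraic over K) y" and "Irr K y = Irr K x"
proof -
  note irr = IrrE[OF K x]
  have "Irr K x \<noteq> []"
    using pirreducibleE(1)[OF subfieldE(1)[OF K] irr(1,2)] .
  then show alg: "(algebraic over K) y"
    using algebraicI[OF irr(1)] y(2) by blast
  show "Irr K y = Irr K x"
    using minimal_polynomial_is_unique[OF K y(1) alg] IrrE[OF K y(1) alg] irr y(2) by blast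
qed

text \<open>A dimension count. Sharing the minimal polynomial of \<open>x\<close>, the element
  \<open>y\<close> has independent powers below the same degree; they lie in the extension generated
  by \<open>x\<close> and are as many as its dimension, so they span it.\<close>

lemma (in domain) simple_extension_eq_of_root:
  assumes K: "subfield K R" and x: "x \<in> carrier R" "(algebraic over K) x"
    and y: "y \<in> simple_extension K x" "eval (Irr K x) y = \<zero>"
  shows "simple_extension K y = simple_extension K x"
proof -
  have yR: "y \<in> carrier R"
    using y(1) simple_extension_in_carrier[OF subfieldE(3)[OF K] x(1)] by blast
  note root = Irr_of_root[OF K x yR y(2)]
  let ?n = "degree (Irr K x)"
  have span: "Span K (exp_base y ?n) = simple_extension K y"
    using Span_exp_base[OF K yR root(1)] root(2) by simp
  have "simple_extension K y \<subseteq> simple_extension K x"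
    using simple_extension_subring_incl[OF simple_extension_is_subring[OF subfieldE(1)[OF K] x(1)]]
      simple_extension_incl[OF subfieldE(3)[OF K] x(1)] y(1) by blast
  moreover have ind: "independent K (exp_base y ?n)"
    using exp_base_independent[OF K yR root(1)] root(2) by simp
  moreover have "set (exp_base y ?n) \<subseteq> simple_extension K y"
    using Span_base_incl[OF K independent_in_carrier[OF ind]] span by simp
  moreover have "length (exp_base y ?n) = ?n"
    by (simp add: exp_base_def)
  ultimately show ?thesis
    using independent_length_eq_dimension[OF K dimension_simple_extension[OF K x] ind] span by auto
qed

text \<open>Evaluation at \<open>x\<close> and evaluation at \<open>y\<close> are homomorphisms on
  \<open>K[X]\<close> with the same kernel, generated by the common minimal polynomial, and the same
  image. Hence sending p(x) to p(y) is a well-defined bijection of the extension onto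
  itself.\<close>

lemma (in domain) relative_automorphism_of_root:
  assumes K: "subfield K R" and x: "x \<in> carrier R" "(algebraic over K) x"
    and y: "y \<in> simple_extension K x" "eval (Irr K x) y = \<zero>"
  obtains \<phi> where "\<phi> \<in> relative_automorphisms K (simple_extension K x)" and "\<phi> x = y"
proof -
  let ?E = "simple_extension K x"
  have Kr: "subring K R" and Kc: "K \<subseteq> carrier R"
    using subfieldE(1,3)[OF K] by auto
  have yR: "y \<in> carrier R"
    using y(1) simple_extension_in_carrier[OF Kc x(1)] by blast
  note root = Irr_of_root[OF K x yR y(2)]
  interpret ex: ring_hom_ring "K[X]" R "\<lambda>p. eval p x"
    using eval_ring_hom[OF Kr x(1)] .
  interpret ey: ring_hom_ring "K[X]" R "\<lambda>p. eval p y"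
    using eval_ring_hom[OF Kr yR] .
  have img_x: "?E = (\<lambda>p. eval p x) ` carrier (K[X])"
    using simple_extension_as_eval_img[OF Kc x(1)] .
  have img_y: "?E = (\<lambda>p. eval p y) ` carrier (K[X])"
    using simple_extension_as_eval_img[OF Kc yR] simple_extension_eq_of_root[OF assms] by simp
  have ker: "a_kernel (K[X]) R (\<lambda>p. eval p x) = a_kernel (K[X]) R (\<lambda>p. eval p y)"
    using Irr_generates_ker[OF K x] Irr_generates_ker[OF K yR root(1)] root(2) by simp
  have eq_iff: "eval p x = eval q x \<longleftrightarrow> eval p y = eval q y"
    if pq: "p \<in> carrier (K[X])" "q \<in> carrier (K[X])" for p q
  proof -
    \<comment> \<open>Two values agree exactly when the difference of the polynomials lies in the
      kernel, and the kernel does not distinguish \<open>x\<close> from \<open>y\<close>. Read from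
      left to right this gives well-definedness, from right to left injectivity.\<close>
    have "eval p x = eval q x \<longleftrightarrow> p \<ominus>\<^bsub>K[X]\<^esub> q \<in> a_kernel (K[X]) R (\<lambda>p. eval p x)"
      using pq ex.R.minus_closed[OF pq] unfolding a_kernel_def' a_minus_def
      by (simp add: r_right_minus_eq[unfolded a_minus_def])
    also have "\<dots> \<longleftrightarrow> eval p y = eval q y"
      using pq ex.R.minus_closed[OF pq] unfolding ker unfolding a_kernel_def' a_minus_def
      by (simp add: r_right_minus_eq[unfolded a_minus_def])
    finally show ?thesis .
  qed
  \<comment> \<open>The polynomial representing \<open>z\<close> is chosen arbitrarily;
    \<open>eq_iff\<close> makes the value independent of the choice.\<close>
  define \<phi> where "\<phi> z = eval (SOME p. p \<in> carrier (K[X]) \<and> eval p x = z) y" for z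
  have \<phi>: "\<phi> (eval p x) = eval p y" if p: "p \<in> carrier (K[X])" for p
    using someI[of "\<lambda>q. q \<in> carrier (K[X]) \<and> eval q x = eval p x" p] p eq_iff
    unfolding \<phi>_def by blast
  have "bij_betw \<phi> ?E ?E"
    unfolding bij_betw_def
  proof
    show "inj_on \<phi> ?E"
      using \<phi> eq_iff unfolding inj_on_def img_x by auto
    show "\<phi> ` ?E = ?E"
    proof -
      have "\<phi> ` ?E = (\<lambda>p. eval p y) ` carrier (K[X])"
        unfolding img_x using \<phi> by (auto simp: image_iff)
      then show ?thesis using img_y by simp
    qed
  qed
  moreover have "\<phi> \<in> ring_hom (R\<lparr>carrier := ?E\<rparr>) (R\<lparr>carrier := ?E\<rparr>)"
  proof (rule ring_hom_memI; simp)
    fix a assume "a \<in> ?E" then show "\<phi> a \<in> ?E"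
      using \<open>bij_betw \<phi> ?E ?E\<close> unfolding bij_betw_def by blast
  next
    fix a b assume "a \<in> ?E" "b \<in> ?E"
    then obtain p q where pq: "p \<in> carrier (K[X])" "q \<in> carrier (K[X])"
      and ab: "a = eval p x" "b = eval q x" unfolding img_x by blast
    show "\<phi> (a \<otimes> b) = \<phi> a \<otimes> \<phi> b"
      using \<phi>[of "p \<otimes>\<^bsub>K[X]\<^esub> q"] \<phi> pq by (simp add: ab)
    show "\<phi> (a \<oplus> b) = \<phi> a \<oplus> \<phi> b"
      using \<phi>[of "p \<oplus>\<^bsub>K[X]\<^esub> q"] \<phi> pq by (simp add: ab)
  next
    show "\<phi> \<one> = \<one>"
      using \<phi>[of "\<one>\<^bsub>K[X]\<^esub>"] by simp
  qed
  moreover have "\<phi> k = k" if k: "k \<in> K" for k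
  \<comment> \<open>The constant polynomial zero is the empty list, since a nonempty coefficient
    list must have a nonzero head; so \<open>[k]\<close> represents \<open>k\<close> only for
    nonzero \<open>k\<close>.\<close>
  proof (cases "k = \<zero>")
    case True
    then show ?thesis using \<phi>[of "\<zero>\<^bsub>K[X]\<^esub>"] by simp
  next
    case False
    have "[k] \<in> carrier (K[X])"
      using k False unfolding univ_poly_def polynomial_def by simp
    then show ?thesis using \<phi>[of "[k]"] k Kc x(1) yR by auto
  qed
  moreover have "\<phi> x = y"
    using \<phi>[OF var_closed(1)[OF Kr]] x(1) yR by (simp add: var_def)
  ultimately show thesis
    using that unfolding relative_automorphisms_def ring_iso_def by auto
qed

text \<open>Links the generated field in the definition of a biquadratic generator with the ring of
  polynomial values in which the computations take place. That ring is already a field because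
  \<open>x\<close> is algebraic.\<close>

lemma (in field) generate_field_insert_algebraic:
  assumes K: "subfield K R" and x: "x \<in> carrier R" "(algebraic over K) x"
  shows "generate_field R (insert x K) = simple_extension K x"
proof (rule generate_fieldI[symmetric])
  show "insert x K \<subseteq> carrier R"
    using subfieldE(3)[OF K] x(1) by simp
  show "subfield (simple_extension K x) R"
    using simple_extension_is_subfield[OF K x(1)] x(2) by simp
  show "insert x K \<subseteq> simple_extension K x"
    using simple_extension_incl[OF subfieldE(3)[OF K] x(1)]
      simple_extension_mem[OF subfieldE(1)[OF K] x(1)] by simp
  show "simple_extension K x \<subseteq> E" if "subfield E R" "insert x K \<subseteq> E" for E
    using simple_extension_subring_incl[OF subfieldE(1)[OF that(1)]] that(2) by simp
qed

section \<open>Arithmetic of a biquadratic generator\<close>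

locale biquadratic_simple_extension = field R for R (structure) +
  fixes K :: "'a set" and \<alpha> u w :: 'a
  assumes char: "\<one> \<oplus> \<one> \<noteq> \<zero>"
    and K: "subfield K R"
    and \<alpha>: "\<alpha> \<in> carrier R" "(algebraic over K) \<alpha>"
    and uw: "u \<in> K" "w \<in> K"
    and minpoly: "Irr K \<alpha> = biquadratic_poly u w"
begin

abbreviation "L \<equiv> simple_extension K \<alpha>"

lemma in_carrier: "K \<subseteq> carrier R" "u \<in> carrier R" "w \<in> carrier R"
  using subfieldE(3)[OF K] uw by auto

lemma subfield_L: "subfield L R"
  using simple_extension_is_subfield[OF K \<alpha>(1)] \<alpha>(2) by simp

lemmas L_ring = subringE[OF subfieldE(1)[OF subfield_L]]

lemma K_subset_L: "K \<subseteq> L"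
  using simple_extension_incl[OF in_carrier(1) \<alpha>(1)] .

lemma \<alpha>_in_L: "\<alpha> \<in> L"
  using simple_extension_mem[OF subfieldE(1)[OF K] \<alpha>(1)] .

text \<open>Grouping by \<open>x \<otimes> x\<close> displays the minimal polynomial as a quadratic
  in the square, the form in which root relations are later subtracted and factored.\<close>

lemma eval_minpoly:
  assumes "x \<in> carrier R"
  shows "eval (Irr K \<alpha>) x = (x \<otimes> x) \<otimes> (x \<otimes> x) \<oplus> u \<otimes> (x \<otimes> x) \<oplus> w"
proof -
  have "eval (Irr K \<alpha>) x = x \<otimes> (x \<otimes> (x \<otimes> x)) \<oplus> (u \<otimes> (x \<otimes> x) \<oplus> w)"
    unfolding minpoly biquadratic_poly_def using assms in_carrier
    by (simp add: numeral_eq_Suc m_ac)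
  also have "\<dots> = (x \<otimes> x) \<otimes> (x \<otimes> x) \<oplus> u \<otimes> (x \<otimes> x) \<oplus> w"
    using assms in_carrier by algebra
  finally show ?thesis .
qed

lemma \<alpha>_root: "(\<alpha> \<otimes> \<alpha>) \<otimes> (\<alpha> \<otimes> \<alpha>) \<oplus> u \<otimes> (\<alpha> \<otimes> \<alpha>) \<oplus> w = \<zero>"
  using IrrE(4)[OF K \<alpha>] eval_minpoly[OF \<alpha>(1)] by simp

lemma two_cancel: "x \<in> carrier R \<Longrightarrow> x \<oplus> x = \<zero> \<Longrightarrow> x = \<zero>"
proof -
  assume x: "x \<in> carrier R" "x \<oplus> x = \<zero>"
  have "(\<one> \<oplus> \<one>) \<otimes> x = \<zero>"
    using x by (simp add: l_distr)
  then show ?thesis using integral[of "\<one> \<oplus> \<one>" x] x(1) char by simp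
qed

text \<open>Otherwise \<open>[a, \<zero>, c]\<close> would be a polynomial of degree 2 vanishing at
  \<alpha>, hence a multiple of a minimal polynomial of degree 4. This is the only form of linear
  independence of the powers of \<alpha> that the fixed field computation uses.\<close>

lemma square_not_root_of_linear:
  assumes ac: "a \<in> K" "c \<in> K" and eq: "a \<otimes> (\<alpha> \<otimes> \<alpha>) \<oplus> c = \<zero>"
  shows "a = \<zero>"
proof (rule ccontr)
  assume "a \<noteq> \<zero>"
  then have p: "[a, \<zero>, c] \<in> carrier (K[X])"
    using ac subringE(2)[OF subfieldE(1)[OF K]] unfolding univ_poly_def polynomial_def by simp
  have "eval [a, \<zero>, c] \<alpha> = \<zero>"
    using ac in_carrier(1) \<alpha>(1) eq by (simp add: numeral_eq_Suc subset_iff)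
  then have "Irr K \<alpha> pdivides [a, \<zero>, c]"
    using Irr_minimal[OF K \<alpha> p] by simp
  then have "degree (Irr K \<alpha>) \<le> degree [a, \<zero>, c]"
    using pdivides_imp_degree_le[OF subfieldE(1)[OF K] IrrE(1)[OF K \<alpha>] p] by simp
  then show False
    unfolding minpoly biquadratic_poly_def by simp
qed

lemma \<alpha>_square_notin: "\<alpha> \<otimes> \<alpha> \<notin> K"
proof
  assume sq: "\<alpha> \<otimes> \<alpha> \<in> K"
  have "\<one> \<otimes> (\<alpha> \<otimes> \<alpha>) \<oplus> \<ominus> (\<alpha> \<otimes> \<alpha>) = \<zero>"
    using \<alpha>(1) by algebra
  then show False
    using square_not_root_of_linear[of \<one> "\<ominus> (\<alpha> \<otimes> \<alpha>)"] sq subringE(3,5)[OF subfieldE(1)[OF K]] by simp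
qed

lemma \<alpha>_nonzero: "\<alpha> \<noteq> \<zero>"
  using \<alpha>_square_notin subringE(2)[OF subfieldE(1)[OF K]] by auto

lemma basis_expansion:
  assumes "x \<in> L"
  obtains a b c d where "a \<in> K" "b \<in> K" "c \<in> K" "d \<in> K"
    "x = a \<otimes> (\<alpha> \<otimes> (\<alpha> \<otimes> \<alpha>)) \<oplus> b \<otimes> (\<alpha> \<otimes> \<alpha>) \<oplus> c \<otimes> \<alpha> \<oplus> d"
proof -
  have "exp_base \<alpha> 4 = [\<alpha> \<otimes> (\<alpha> \<otimes> \<alpha>), \<alpha> \<otimes> \<alpha>, \<alpha>, \<one>]"
    using \<alpha>(1) by (simp add: exp_base_def numeral_eq_Suc m_ac)
  moreover have "degree (Irr K \<alpha>) = 4"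
    unfolding minpoly biquadratic_poly_def by simp
  ultimately have "L = Span K [\<alpha> \<otimes> (\<alpha> \<otimes> \<alpha>), \<alpha> \<otimes> \<alpha>, \<alpha>, \<one>]"
    using Span_exp_base[OF K \<alpha>] by metis
  then obtain a b c d where k: "a \<in> K" "b \<in> K" "c \<in> K" "d \<in> K"
    and x: "x = a \<otimes> (\<alpha> \<otimes> (\<alpha> \<otimes> \<alpha>)) \<oplus> (b \<otimes> (\<alpha> \<otimes> \<alpha>) \<oplus> (c \<otimes> \<alpha> \<oplus> (d \<otimes> \<one> \<oplus> \<zero>)))"
    using assms by (auto simp: line_extension_mem_iff)
  have "x = a \<otimes> (\<alpha> \<otimes> (\<alpha> \<otimes> \<alpha>)) \<oplus> b \<otimes> (\<alpha> \<otimes> \<alpha>) \<oplus> c \<otimes> \<alpha> \<oplus> d"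
    unfolding x using k in_carrier(1) \<alpha>(1) by (simp add: subset_iff a_ac)
  with k show thesis using that by blast
qed

lemma relative_automorphism_hom:
  assumes \<phi>: "\<phi> \<in> relative_automorphisms K L"
  shows "x \<in> L \<Longrightarrow> \<phi> x \<in> L"
    and "x \<in> L \<Longrightarrow> y \<in> L \<Longrightarrow> \<phi> (x \<otimes> y) = \<phi> x \<otimes> \<phi> y"
    and "x \<in> L \<Longrightarrow> y \<in> L \<Longrightarrow> \<phi> (x \<oplus> y) = \<phi> x \<oplus> \<phi> y"
    and "k \<in> K \<Longrightarrow> \<phi> k = k"
  using \<phi> unfolding relative_automorphisms_def ring_iso_def ring_hom_def by auto

text \<open>Turns invariance of an element under an automorphism into a relation between its
  coordinates, \<alpha> and the image of \<alpha>.\<close>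

lemma relative_automorphism_expansion:
  assumes \<phi>: "\<phi> \<in> relative_automorphisms K L" and k: "a \<in> K" "b \<in> K" "c \<in> K" "d \<in> K"
  shows "\<phi> (a \<otimes> (\<alpha> \<otimes> (\<alpha> \<otimes> \<alpha>)) \<oplus> b \<otimes> (\<alpha> \<otimes> \<alpha>) \<oplus> c \<otimes> \<alpha> \<oplus> d) =
    a \<otimes> (\<phi> \<alpha> \<otimes> (\<phi> \<alpha> \<otimes> \<phi> \<alpha>)) \<oplus> b \<otimes> (\<phi> \<alpha> \<otimes> \<phi> \<alpha>) \<oplus> c \<otimes> \<phi> \<alpha> \<oplus> d"
  using relative_automorphism_hom[OF \<phi>] k K_subset_L \<alpha>_in_L L_ring(6,7) by (simp add: subset_iff)

section \<open>The Galois property and square roots of \<open>w\<close> in the extension\<close>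

lemma galois_imp_constant_square:
  assumes gal: "galois_extension K L"
  obtains y where "y \<in> L" "y \<otimes> y = w"
proof -
  obtain \<phi> where \<phi>: "\<phi> \<in> relative_automorphisms K L" and moved: "\<phi> (\<alpha> \<otimes> \<alpha>) \<noteq> \<alpha> \<otimes> \<alpha>"
    using gal \<alpha>_square_notin L_ring(6)[OF \<alpha>_in_L \<alpha>_in_L] unfolding galois_extension_def by blast
  note hom = relative_automorphism_hom[OF \<phi>]
  define \<beta> where "\<beta> = \<phi> \<alpha>"
  have \<beta>: "\<beta> \<in> L" "\<beta> \<in> carrier R"
    using hom(1)[OF \<alpha>_in_L] L_ring(1) unfolding \<beta>_def by auto
  have "\<phi> ((\<alpha> \<otimes> \<alpha>) \<otimes> (\<alpha> \<otimes> \<alpha>) \<oplus> u \<otimes> (\<alpha> \<otimes> \<alpha>) \<oplus> w) =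
      (\<beta> \<otimes> \<beta>) \<otimes> (\<beta> \<otimes> \<beta>) \<oplus> u \<otimes> (\<beta> \<otimes> \<beta>) \<oplus> w"
    unfolding \<beta>_def using hom uw K_subset_L \<alpha>_in_L L_ring(6,7) by (simp add: subset_iff)
  then have \<beta>_root: "(\<beta> \<otimes> \<beta>) \<otimes> (\<beta> \<otimes> \<beta>) \<oplus> u \<otimes> (\<beta> \<otimes> \<beta>) \<oplus> w = \<zero>"
    using \<alpha>_root hom(4)[of \<zero>] subringE(2)[OF subfieldE(1)[OF K]] by simp
  have ne: "\<beta> \<otimes> \<beta> \<noteq> \<alpha> \<otimes> \<alpha>"
    using moved hom(2)[OF \<alpha>_in_L \<alpha>_in_L] unfolding \<beta>_def by simp
  \<comment> \<open>Subtracting the two root relations leaves a multiple of the difference of the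
    squares, which is nonzero by the choice of \<phi>. The cofactor therefore vanishes: this is the
    Vieta relation for the sum of the roots.\<close>
  have "(\<beta> \<otimes> \<beta> \<ominus> \<alpha> \<otimes> \<alpha>) \<otimes> (\<alpha> \<otimes> \<alpha> \<oplus> \<beta> \<otimes> \<beta> \<oplus> u) =
      ((\<beta> \<otimes> \<beta>) \<otimes> (\<beta> \<otimes> \<beta>) \<oplus> u \<otimes> (\<beta> \<otimes> \<beta>) \<oplus> w) \<ominus>
      ((\<alpha> \<otimes> \<alpha>) \<otimes> (\<alpha> \<otimes> \<alpha>) \<oplus> u \<otimes> (\<alpha> \<otimes> \<alpha>) \<oplus> w)"
    using \<alpha>(1) \<beta>(2) in_carrier by algebra
  also have "\<dots> = \<zero>"
    unfolding \<alpha>_root \<beta>_root by simp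
  finally have sum: "\<alpha> \<otimes> \<alpha> \<oplus> \<beta> \<otimes> \<beta> \<oplus> u = \<zero>"
    using ne integral_iff \<alpha>(1) \<beta>(2) in_carrier by (simp add: r_right_minus_eq)
  \<comment> \<open>The Vieta relation for the product, arranged so that both terms added to
    \<open>w\<close> are known to be zero.\<close>
  have "(\<alpha> \<otimes> \<beta>) \<otimes> (\<alpha> \<otimes> \<beta>) = w \<oplus> (\<alpha> \<otimes> \<alpha>) \<otimes> (\<alpha> \<otimes> \<alpha> \<oplus> \<beta> \<otimes> \<beta> \<oplus> u) \<ominus>
      ((\<alpha> \<otimes> \<alpha>) \<otimes> (\<alpha> \<otimes> \<alpha>) \<oplus> u \<otimes> (\<alpha> \<otimes> \<alpha>) \<oplus> w)"
    using \<alpha>(1) \<beta>(2) in_carrier by algebra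
  also have "\<dots> = w"
    unfolding \<alpha>_root sum using \<alpha>(1) in_carrier by (simp add: a_minus_def)
  finally have "(\<alpha> \<otimes> \<beta>) \<otimes> (\<alpha> \<otimes> \<beta>) = w" .
  then show thesis
    using that L_ring(6)[OF \<alpha>_in_L \<beta>(1)] by blast
qed

text \<open>Dividing the root relation of \<alpha> by its square gives the formula for
  \<open>u\<close>. Solved for \<open>u\<close>, it allows both coefficients to be eliminated, so
  that later claims become polynomial identities in \<alpha> and \<beta>.\<close>

lemma complementary_root:
  assumes y: "y \<in> L" "y \<otimes> y = w"
  obtains \<beta> where "\<beta> \<in> L" "\<alpha> \<otimes> \<beta> = y" "u = \<ominus> (\<alpha> \<otimes> \<alpha> \<oplus> \<beta> \<otimes> \<beta>)"
proof -
  have inv: "inv \<alpha> \<in> L" "inv \<alpha> \<in> carrier R" "\<alpha> \<otimes> inv \<alpha> = \<one>"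
    using subfield_m_inv[OF subfield_L] \<alpha>_in_L \<alpha>_nonzero L_ring(1) by auto
  have yR: "y \<in> carrier R" using y(1) L_ring(1) by blast
  define \<beta> where "\<beta> = inv \<alpha> \<otimes> y"
  have \<beta>: "\<beta> \<in> L" "\<beta> \<in> carrier R" "\<alpha> \<otimes> \<beta> = y"
    unfolding \<beta>_def using inv y(1) L_ring(6) yR \<alpha>(1) by (auto simp: m_assoc[symmetric])
  have "(\<alpha> \<otimes> \<alpha>) \<otimes> (\<alpha> \<otimes> \<alpha> \<oplus> \<beta> \<otimes> \<beta> \<oplus> u) =
      (\<alpha> \<otimes> \<alpha>) \<otimes> (\<alpha> \<otimes> \<alpha>) \<oplus> u \<otimes> (\<alpha> \<otimes> \<alpha>) \<oplus> (\<alpha> \<otimes> \<beta>) \<otimes> (\<alpha> \<otimes> \<beta>)"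
    using \<alpha>(1) \<beta>(2) in_carrier by algebra
  then have "(\<alpha> \<otimes> \<alpha>) \<otimes> (\<alpha> \<otimes> \<alpha> \<oplus> \<beta> \<otimes> \<beta> \<oplus> u) = \<zero>"
    using \<alpha>_root \<beta>(3) y(2) by simp
  then have "u \<oplus> (\<alpha> \<otimes> \<alpha> \<oplus> \<beta> \<otimes> \<beta>) = \<zero>"
    using \<alpha>_nonzero integral_iff \<alpha>(1) \<beta>(2) in_carrier by (simp add: a_comm)
  then have "u = \<ominus> (\<alpha> \<otimes> \<alpha> \<oplus> \<beta> \<otimes> \<beta>)"
    using minus_equality \<alpha>(1) \<beta>(2) in_carrier by simp
  with \<beta> that show thesis by blast
qed

lemma constant_square_imp_galois:
  assumes y: "y \<in> L" "y \<otimes> y = w"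
  shows "galois_extension K L"
proof -
  obtain \<beta> where \<beta>: "\<beta> \<in> L" "\<alpha> \<otimes> \<beta> = y" and u_eq: "u = \<ominus> (\<alpha> \<otimes> \<alpha> \<oplus> \<beta> \<otimes> \<beta>)"
    using complementary_root[OF y] .
  have \<beta>R: "\<beta> \<in> carrier R" using \<beta>(1) L_ring(1) by blast
  have w_eq: "w = (\<alpha> \<otimes> \<beta>) \<otimes> (\<alpha> \<otimes> \<beta>)"
    using \<beta>(2) y(2) by simp
  have "eval (Irr K \<alpha>) \<beta> = \<zero>"
    unfolding eval_minpoly[OF \<beta>R] unfolding u_eq w_eq using \<alpha>(1) \<beta>R by algebra
  then obtain \<tau> where \<tau>: "\<tau> \<in> relative_automorphisms K L" "\<tau> \<alpha> = \<beta>"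
    using relative_automorphism_of_root[OF K \<alpha> \<beta>(1)] by blast
  \<comment> \<open>Only even powers occur, so the sign change preserves the value.\<close>
  have "eval (Irr K \<alpha>) (\<ominus> \<alpha>) = eval (Irr K \<alpha>) \<alpha>"
    using \<alpha>(1) by (simp add: eval_minpoly l_minus r_minus)
  then obtain \<phi> where \<phi>: "\<phi> \<in> relative_automorphisms K L" "\<phi> \<alpha> = \<ominus> \<alpha>"
    using relative_automorphism_of_root[OF K \<alpha> L_ring(5)[OF \<alpha>_in_L]] IrrE(4)[OF K \<alpha>] by metis
  have "x \<in> K" if x: "x \<in> L" and fixed: "\<forall>\<phi> \<in> relative_automorphisms K L. \<phi> x = x" for x
  proof -
    obtain a b c d where k: "a \<in> K" "b \<in> K" "c \<in> K" "d \<in> K"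
      and x_eq: "x = a \<otimes> (\<alpha> \<otimes> (\<alpha> \<otimes> \<alpha>)) \<oplus> b \<otimes> (\<alpha> \<otimes> \<alpha>) \<oplus> c \<otimes> \<alpha> \<oplus> d"
      using basis_expansion[OF x] .
    have kR: "a \<in> carrier R" "b \<in> carrier R" "c \<in> carrier R" "d \<in> carrier R"
      using k in_carrier(1) by auto
    have xR: "x \<in> carrier R"
      using x L_ring(1) by blast
    have x_eq': "x = a \<otimes> (\<ominus> \<alpha> \<otimes> (\<ominus> \<alpha> \<otimes> \<ominus> \<alpha>)) \<oplus> b \<otimes> (\<ominus> \<alpha> \<otimes> \<ominus> \<alpha>) \<oplus> c \<otimes> \<ominus> \<alpha> \<oplus> d"
      using relative_automorphism_expansion[OF \<phi>(1) k, folded x_eq]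
      unfolding bspec[OF fixed \<phi>(1)] \<phi>(2) .
    \<comment> \<open>Subtracting the image under the sign change leaves twice the odd part.
      Cancelling 2 and \<alpha> yields a relation that is linear in the square of \<alpha>.\<close>
    have "\<alpha> \<otimes> (a \<otimes> (\<alpha> \<otimes> \<alpha>) \<oplus> c) \<oplus> \<alpha> \<otimes> (a \<otimes> (\<alpha> \<otimes> \<alpha>) \<oplus> c) =
        (a \<otimes> (\<alpha> \<otimes> (\<alpha> \<otimes> \<alpha>)) \<oplus> b \<otimes> (\<alpha> \<otimes> \<alpha>) \<oplus> c \<otimes> \<alpha> \<oplus> d) \<ominus>
        (a \<otimes> (\<ominus> \<alpha> \<otimes> (\<ominus> \<alpha> \<otimes> \<ominus> \<alpha>)) \<oplus> b \<otimes> (\<ominus> \<alpha> \<otimes> \<ominus> \<alpha>) \<oplus> c \<otimes> \<ominus> \<alpha> \<oplus> d)"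
      using kR \<alpha>(1) by algebra
    also have "\<dots> = \<zero>"
      unfolding x_eq[symmetric] x_eq'[symmetric] using xR by simp
    finally have "\<alpha> \<otimes> (a \<otimes> (\<alpha> \<otimes> \<alpha>) \<oplus> c) = \<zero>"
      by (rule two_cancel[rotated]) (use kR \<alpha>(1) in simp)
    then have ac: "a \<otimes> (\<alpha> \<otimes> \<alpha>) \<oplus> c = \<zero>"
      using \<alpha>_nonzero integral_iff kR \<alpha>(1) by simp
    then have a: "a = \<zero>"
      by (rule square_not_root_of_linear[OF k(1,3)])
    then have c: "c = \<zero>"
      using ac kR \<alpha>(1) by simp
    have "x = a \<otimes> (\<beta> \<otimes> (\<beta> \<otimes> \<beta>)) \<oplus> b \<otimes> (\<beta> \<otimes> \<beta>) \<oplus> c \<otimes> \<beta> \<oplus> d"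
      using relative_automorphism_expansion[OF \<tau>(1) k, folded x_eq]
      unfolding bspec[OF fixed \<tau>(1)] \<tau>(2) .
    then have "b \<otimes> (\<beta> \<otimes> \<beta>) \<oplus> d = b \<otimes> (\<alpha> \<otimes> \<alpha>) \<oplus> d"
      using x_eq a c kR \<alpha>(1) \<beta>R by simp
    \<comment> \<open>The square of \<beta>, which need not be in \<open>K\<close> and is not a
      coordinate, is replaced by means of \<open>u\<close>. The result is again linear in the square
      of \<alpha> over \<open>K\<close>, now with leading coefficient
      \<open>b \<oplus> b\<close>.\<close>
    moreover have "(b \<oplus> b) \<otimes> (\<alpha> \<otimes> \<alpha>) \<oplus> b \<otimes> u =
        (b \<otimes> (\<alpha> \<otimes> \<alpha>) \<oplus> d) \<ominus> (b \<otimes> (\<beta> \<otimes> \<beta>) \<oplus> d)"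
      unfolding u_eq using kR \<alpha>(1) \<beta>R by algebra
    ultimately have "(b \<oplus> b) \<otimes> (\<alpha> \<otimes> \<alpha>) \<oplus> b \<otimes> u = \<zero>"
      using kR \<alpha>(1) \<beta>R by (simp add: r_right_minus_eq)
    then have "b \<oplus> b = \<zero>"
      by (rule square_not_root_of_linear[rotated 2])
        (use k(2) uw(1) subringE(6,7)[OF subfieldE(1)[OF K]] in auto)
    then have "b = \<zero>"
      by (rule two_cancel[OF kR(2)])
    then show "x \<in> K"
      using x_eq a c k(4) kR \<alpha>(1) by simp
  qed
  moreover have "(algebraic over K) x" if "x \<in> L" for x
    using simple_extesion_mem_imp_algebraic[OF K \<alpha>(1)] \<alpha>(2) that by blast
  ultimately show ?thesis
    using K subfield_L K_subset_L relative_automorphism_hom(4)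
    unfolding galois_extension_def subfield_extension_def by blast
qed

end

section \<open>Equivalence of the three conditions\<close>

lemma (in ring) mem_squares_iff:
  assumes "E \<subseteq> carrier R" shows "x \<in> squares E \<longleftrightarrow> (\<exists>y\<in>E. y \<otimes> y = x)"
proof -
  have "y [^] (2::nat) = y \<otimes> y" if "y \<in> E" for y
    using that assms by (auto simp: numeral_2_eq_2)
  then show ?thesis unfolding squares_def by (auto simp: image_iff)
qed

theorem lemma2p6:
  fixes \<Omega> (structure) and F L :: "'a set" and \<alpha> u w \<omega> :: 'a
  assumes closure: "algebraic_closure \<Omega> F"
    and char: "\<one> \<oplus> \<one> \<noteq> \<zero>"
    and ext: "ring.biquadratic_extension \<Omega> F L"
    and gen: "ring.biquadratic_generator \<Omega> F L \<alpha>"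
    and uw: "u \<in> F" "w \<in> F"
    and minpoly: "ring.Irr \<Omega> F \<alpha> = ring.biquadratic_poly \<Omega> u w"
    and omega: "\<omega> \<in> carrier \<Omega>" "\<omega> [^] (2::nat) = w"
  shows "(ring.galois_extension \<Omega> F L \<longleftrightarrow>
            u [^] (2::nat) \<ominus> [(4::nat)] \<cdot> w \<in> ring.squares \<Omega> L \<and>
            \<ominus> u \<oplus> [(2::nat)] \<cdot> \<omega> \<in> ring.squares \<Omega> L \<and>
            \<ominus> u \<ominus> [(2::nat)] \<cdot> \<omega> \<in> ring.squares \<Omega> L) \<and>
         (ring.galois_extension \<Omega> F L \<longleftrightarrow> w \<in> ring.squares \<Omega> L)"
proof -
  interpret algebraic_closure \<Omega> F by fact
  have F: "subfield F \<Omega>" and L: "subfield L \<Omega>"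
    using ext unfolding biquadratic_extension_def subfield_extension_def by auto
  note L_ring = subringE[OF subfieldE(1)[OF L]]
  have FL: "F \<subseteq> L"
    using ext unfolding biquadratic_extension_def subfield_extension_def by auto
  have \<alpha>: "\<alpha> \<in> carrier \<Omega>" "(algebraic over F) \<alpha>"
    using gen L_ring(1) unfolding biquadratic_generator_def by auto
  interpret B: biquadratic_simple_extension \<Omega> F \<alpha> u w
    by unfold_locales (use char F \<alpha> uw minpoly in auto)
  have L_eq: "simple_extension F \<alpha> = L"
    using generate_field_insert_algebraic[OF F \<alpha>] gen unfolding biquadratic_generator_def by simp
  note R = B.in_carrier(2,3) omega(1) \<alpha>(1)
  have \<omega>2: "\<omega> \<otimes> \<omega> = w"
    using omega by (simp add: numeral_2_eq_2)
  have two: "[(2::nat)] \<cdot> \<omega> = \<omega> \<oplus> \<omega>" and four: "[(4::nat)] \<cdot> w = w \<oplus> w \<oplus> w \<oplus> w"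
    using R by (simp_all add: numeral_eq_Suc)
  have usq: "u [^] (2::nat) = u \<otimes> u"
    using R by (simp add: numeral_2_eq_2)
  note sq = mem_squares_iff[OF L_ring(1)]
  \<comment> \<open>Any square root of \<open>w\<close> is \<omega> or its negative, so one of them
    lies in \<open>L\<close> exactly when \<omega> does. Membership of \<omega> is the common form
    to which the second and third conditions are reduced.\<close>
  have \<omega>_iff: "w \<in> squares L \<longleftrightarrow> \<omega> \<in> L"
  proof
    assume "w \<in> squares L"
    then obtain y where y: "y \<in> L" "y \<otimes> y = w" using sq by blast
    then have yR: "y \<in> carrier \<Omega>" using L_ring(1) by blast
    have "(\<omega> \<ominus> y) \<otimes> (\<omega> \<oplus> y) = \<omega> \<otimes> \<omega> \<ominus> y \<otimes> y"
      using yR R by algebra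
    then have "(\<omega> \<ominus> y) \<otimes> (\<omega> \<oplus> y) = \<zero>"
      using \<omega>2 y(2) R by simp
    then have "\<omega> \<ominus> y = \<zero> \<or> \<omega> \<oplus> y = \<zero>"
      using integral[of "\<omega> \<ominus> y" "\<omega> \<oplus> y"] yR R by simp
    then have "\<omega> = y \<or> \<omega> = \<ominus> y"
      using yR R minus_equality[of \<omega> y] by (auto simp: r_right_minus_eq)
    then show "\<omega> \<in> L" using y(1) L_ring(5) by auto
  qed (use \<omega>2 sq in blast)
  \<comment> \<open>If the element is the square of \<open>y\<close>, then \<omega> is half of the
    sum of that square and \<open>u\<close>; halving stays in \<open>L\<close> because the
    characteristic is not 2.\<close>
  have "\<omega> \<in> L" if h: "\<ominus> u \<oplus> [(2::nat)] \<cdot> \<omega> \<in> squares L"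
  proof -
    obtain y where y: "y \<in> L" "y \<otimes> y = \<ominus> u \<oplus> (\<omega> \<oplus> \<omega>)"
      using h sq unfolding two by blast
    then have yR: "y \<in> carrier \<Omega>" using L_ring(1) by blast
    let ?t = "\<one> \<oplus> \<one>"
    have t: "?t \<in> L" "?t \<in> carrier \<Omega>" and inv: "inv ?t \<in> L" "inv ?t \<in> carrier \<Omega>" "inv ?t \<otimes> ?t = \<one>"
      using subfield_m_inv[OF L, of ?t] L_ring(1,3,7) char by auto
    have "?t \<otimes> \<omega> = y \<otimes> y \<oplus> u"
      unfolding y(2) using R by algebra
    then have "\<omega> = inv ?t \<otimes> (y \<otimes> y \<oplus> u)"
      using inv(2,3) t(2) R m_assoc[of "inv ?t" ?t \<omega>] by simp
    then show ?thesis using inv(1) y(1) uw(1) FL L_ring(6,7) by (simp add: subset_iff)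
  qed
  moreover have "u [^] (2::nat) \<ominus> [(4::nat)] \<cdot> w \<in> squares L \<and>
      \<ominus> u \<oplus> [(2::nat)] \<cdot> \<omega> \<in> squares L \<and> \<ominus> u \<ominus> [(2::nat)] \<cdot> \<omega> \<in> squares L" if \<omega>L: "\<omega> \<in> L"
  proof -
    obtain \<beta> where \<beta>: "\<beta> \<in> L" "\<alpha> \<otimes> \<beta> = \<omega>" and u_eq: "u = \<ominus> (\<alpha> \<otimes> \<alpha> \<oplus> \<beta> \<otimes> \<beta>)"
      using B.complementary_root \<omega>L \<omega>2 unfolding L_eq by blast
    have \<beta>R: "\<beta> \<in> carrier \<Omega>" using \<beta>(1) L_ring(1) by blast
    note \<alpha>L = B.\<alpha>_in_L[unfolded L_eq]
    have neg: "\<ominus> \<beta> \<in> L" "\<ominus> (\<beta> \<otimes> \<beta>) \<in> L"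
      using \<beta>(1) L_ring(5,6) by auto
    \<comment> \<open>Differences are written as sums with negatives, so that the closure rules of
      \<open>L\<close> apply directly to the square roots exhibited here.\<close>
    have "(\<alpha> \<otimes> \<alpha> \<oplus> \<ominus> (\<beta> \<otimes> \<beta>)) \<otimes> (\<alpha> \<otimes> \<alpha> \<oplus> \<ominus> (\<beta> \<otimes> \<beta>)) = u [^] (2::nat) \<ominus> [(4::nat)] \<cdot> w"
      unfolding usq four unfolding \<omega>2[symmetric] \<beta>(2)[symmetric] u_eq using \<beta>R \<alpha>(1) by algebra
    moreover have "(\<alpha> \<oplus> \<beta>) \<otimes> (\<alpha> \<oplus> \<beta>) = \<ominus> u \<oplus> [(2::nat)] \<cdot> \<omega>"
      unfolding two unfolding \<beta>(2)[symmetric] u_eq using \<beta>R \<alpha>(1) by algebra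
    moreover have "(\<alpha> \<oplus> \<ominus> \<beta>) \<otimes> (\<alpha> \<oplus> \<ominus> \<beta>) = \<ominus> u \<ominus> [(2::nat)] \<cdot> \<omega>"
      unfolding two unfolding \<beta>(2)[symmetric] u_eq using \<beta>R \<alpha>(1) by algebra
    ultimately show ?thesis
      using sq \<alpha>L \<beta>(1) neg L_ring(6,7) by blast
  qed
  moreover have "galois_extension F L \<longleftrightarrow> w \<in> squares L"
  proof
    assume "galois_extension F L"
    then obtain y where "y \<in> L" "y \<otimes> y = w"
      by (rule B.galois_imp_constant_square[unfolded L_eq])
    then show "w \<in> squares L" unfolding sq by blast
  next
    assume "w \<in> squares L"
    then obtain y where "y \<in> L" "y \<otimes> y = w" unfolding sq by blast
    then show "galois_extension F L"
      by (rule B.constant_square_imp_galois[unfolded L_eq])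
  qed
  ultimately show ?thesis
    using \<omega>_iff by blast
qed

end
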